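(* Let $\alpha=\alpha(s)$ be a helix in the Euclidean space $\mathrm{E}^4$ with non-zero (constant) curvatures $\kappa,\tau,\sigma$. Then: 1. $\alpha$ cannot be a generalized helix. 2. $\alpha$ cannot be a 3-type slant helix. 3. If $\alpha$ lies on a hypersphere of $\mathrm{E}^4$, then the radius of this hypersphere is equal to $\frac{\sqrt{\tau^2+\sigma^2}}{|\kappa\,\sigma|}$.
   Context: $\mathrm{E}^4$ is $\mathbb{R}^4$ with its standard inner product. A unit speed curve $\alpha=\alpha(s)$ has Frenet-Serret frame $\{T,N,B,E\}$ (tangent, normal, binormal, trinormal; an orthonormal frame along $\alpha$ with $T=\alpha'$) and first, second and third curvatures $\kappa,\tau,\sigma$ satisfying $T'=\kappa N$, $N'=-\kappa T+\tau B$, $B'=-\tau N+\sigma E$, $E'=-\sigma B$. A helix (also called W-curve) in $\mathrm{E}^4$ is a curve whose curvatures $\kappa,\tau,\sigma$ are constant. A curve is a generalized helix (general helix, inclined curve) if its tangent vector field $T$ makes a constant angle with a fixed unit vector $U$. A curve is a 3-type slant helix if its trinormal vector field $E$ makes a constant angle with a fixed direction (fixed unit vector) $U$. *)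

theory Defs
  imports "HOL-Analysis.Analysis"
begin

definition angle_between :: "'a::real_inner \<Rightarrow> 'a \<Rightarrow> real" where
  "angle_between u v = arccos ((u \<bullet> v) / (norm u * norm v))"

definition orthonormal4 :: "real^4 \<Rightarrow> real^4 \<Rightarrow> real^4 \<Rightarrow> real^4 \<Rightarrow> bool" where
  "orthonormal4 t n b e \<longleftrightarrow>
     norm t = 1 \<and> norm n = 1 \<and> norm b = 1 \<and> norm e = 1 \<and>
     t \<bullet> n = 0 \<and> t \<bullet> b = 0 \<and> t \<bullet> e = 0 \<and> n \<bullet> b = 0 \<and> n \<bullet> e = 0 \<and> b \<bullet> e = 0"

text \<open>
  A curve \<open>\<alpha>\<close> on an interval \<open>I\<close> with Frenet-Serret frame \<open>T, N, B, E\<close> and curvatures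
  \<open>\<kappa>, \<tau>, \<sigma>\<close>. The interval is nondegenerate but need not be open; derivatives are taken
  within \<open>I\<close>, so they are one-sided at an end point belonging to \<open>I\<close>. Unit speed is
  contained in \<open>\<alpha>' = T\<close> and \<open>norm (T s) = 1\<close>. No sign is imposed on the curvatures.
\<close>

definition frenet_curve4 ::
  "real set \<Rightarrow> (real \<Rightarrow> real^4) \<Rightarrow>
   (real \<Rightarrow> real^4) \<Rightarrow> (real \<Rightarrow> real^4) \<Rightarrow> (real \<Rightarrow> real^4) \<Rightarrow> (real \<Rightarrow> real^4) \<Rightarrow>
   (real \<Rightarrow> real) \<Rightarrow> (real \<Rightarrow> real) \<Rightarrow> (real \<Rightarrow> real) \<Rightarrow> bool" where
  "frenet_curve4 I \<alpha> T N B E \<kappa> \<tau> \<sigma> \<longleftrightarrow>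
     is_interval I \<and> interior I \<noteq> {} \<and>
     (\<forall>s\<in>I.
        orthonormal4 (T s) (N s) (B s) (E s) \<and>
        (\<alpha> has_vector_derivative T s) (at s within I) \<and>
        (T has_vector_derivative \<kappa> s *\<^sub>R N s) (at s within I) \<and>
        (N has_vector_derivative - \<kappa> s *\<^sub>R T s + \<tau> s *\<^sub>R B s) (at s within I) \<and>
        (B has_vector_derivative - \<tau> s *\<^sub>R N s + \<sigma> s *\<^sub>R E s) (at s within I) \<and>
        (E has_vector_derivative - \<sigma> s *\<^sub>R B s) (at s within I))"

definition helix4 ::
  "real set \<Rightarrow> (real \<Rightarrow> real^4) \<Rightarrow>
   (real \<Rightarrow> real^4) \<Rightarrow> (real \<Rightarrow> real^4) \<Rightarrow> (real \<Rightarrow> real^4) \<Rightarrow> (real \<Rightarrow> real^4) \<Rightarrow>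
   (real \<Rightarrow> real) \<Rightarrow> (real \<Rightarrow> real) \<Rightarrow> (real \<Rightarrow> real) \<Rightarrow> bool" where
  "helix4 I \<alpha> T N B E \<kappa> \<tau> \<sigma> \<longleftrightarrow>
     frenet_curve4 I \<alpha> T N B E \<kappa> \<tau> \<sigma> \<and>
     \<kappa> constant_on I \<and> \<tau> constant_on I \<and> \<sigma> constant_on I"

text \<open>The constant angle may be any value in \<open>[0, \<pi>]\<close>, including \<open>\<pi> / 2\<close>.\<close>

definition makes_constant_angle :: "real set \<Rightarrow> (real \<Rightarrow> real^4) \<Rightarrow> bool" where
  "makes_constant_angle I V \<longleftrightarrow>
     (\<exists>U. norm U = 1 \<and> (\<lambda>s. angle_between (V s) U) constant_on I)"

text \<open>Both notions depend on the curve only through one field of its Frenet frame: the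
  tangent \<open>T\<close> for a generalized helix and the trinormal \<open>E\<close> for a 3-type slant helix.\<close>

definition generalized_helix :: "real set \<Rightarrow> (real \<Rightarrow> real^4) \<Rightarrow> bool" where
  "generalized_helix I T \<longleftrightarrow> makes_constant_angle I T"

definition slant_helix_type3 :: "real set \<Rightarrow> (real \<Rightarrow> real^4) \<Rightarrow> bool" where
  "slant_helix_type3 I E \<longleftrightarrow> makes_constant_angle I E"

end

theory Submission
  imports Defs
begin

text \<open>
  Let \<open>X\<close> be a vector field along the curve with \<open>X' = a *\<^sub>R T\<close> for a constant \<open>a\<close>. Two cases
  occur below: a fixed direction \<open>U\<close> (\<open>a = 0\<close>) and the position vector \<open>\<alpha> - c\<close> relative
  to the centre of a sphere (\<open>a = 1\<close>). With constant curvatures \<open>k, t, w\<close>, the Frenet equations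
  turn into linear equations with constant coefficients between the frame coordinates of \<open>X\<close>:
  whenever one of the coordinates is constant along the curve, its derivative vanishes, and that
  is a relation between the neighbouring coordinates.

  If \<open>X \<bullet> T\<close> is constant, these relations, together with \<open>k, t, w \<noteq> 0\<close>, can be applied one
  after the other and determine all coordinates (\<open>coordinates_if_tangential_constant\<close>):
  \<open>X \<bullet> T = X \<bullet> B = 0\<close>, \<open>X \<bullet> N = - a / k\<close>, \<open>X \<bullet> E = - a t / (k w)\<close>. By the Pythagorean identity
  in the frame,
  \[ X \bullet X = a^2 (t^2 + w^2) / (k w)^2. \]
  For \<open>X = U\<close> this says \<open>U = 0\<close>, so the tangent makes a constant angle with no unit vector. On
  a sphere, \<open>\<alpha> - c\<close> is orthogonal to \<open>T\<close>, and the formula with \<open>a = 1\<close> is the radius. For the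
  trinormal the chain of relations is run through in the opposite direction, from \<open>E\<close> to \<open>T\<close>,
  and back again to \<open>E\<close>; this too forces \<open>U = 0\<close> (\<open>zero_if_trinormal_constant\<close>).
\<close>

text \<open>Four orthonormal vectors are independent, hence for dimension reasons a basis.\<close>

lemma orthonormal4_Parseval:
  assumes "orthonormal4 t n b e"
  shows "x \<bullet> x = (x \<bullet> t)\<^sup>2 + (x \<bullet> n)\<^sup>2 + (x \<bullet> b)\<^sup>2 + (x \<bullet> e)\<^sup>2"
proof -
  let ?S = "{t, n, b, e}"
  have unit: "t \<bullet> t = 1" "n \<bullet> n = 1" "b \<bullet> b = 1" "e \<bullet> e = 1"
    and orth: "t \<bullet> n = 0" "t \<bullet> b = 0" "t \<bullet> e = 0" "n \<bullet> b = 0" "n \<bullet> e = 0" "b \<bullet> e = 0"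
    using assms by (auto simp: orthonormal4_def norm_eq_1)
  have distinct: "t \<noteq> n" "t \<noteq> b" "t \<noteq> e" "n \<noteq> b" "n \<noteq> e" "b \<noteq> e"
    using unit orth by auto
  have pw: "pairwise orthogonal ?S"
    using orth by (auto simp: pairwise_def orthogonal_def inner_commute)
  have "independent ?S"
    using pw unit by (intro pairwise_orthogonal_independent) auto
  moreover have "card ?S = 4"
    using distinct by simp
  ultimately have "UNIV \<subseteq> span ?S"
    by (intro card_ge_dim_independent) (auto simp: dim_UNIV)
  then have "(\<Sum>v\<in>?S. (x \<bullet> v) *\<^sub>R v) = x"
    using pw unit by (intro orthonormal_basis_expand) (auto simp: norm_eq_1)
  then have "x = (x \<bullet> t) *\<^sub>R t + (x \<bullet> n) *\<^sub>R n + (x \<bullet> b) *\<^sub>R b + (x \<bullet> e) *\<^sub>R e"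
    using distinct by (simp add: add.assoc)
  then have "x \<bullet> x = x \<bullet> ((x \<bullet> t) *\<^sub>R t + (x \<bullet> n) *\<^sub>R n + (x \<bullet> b) *\<^sub>R b + (x \<bullet> e) *\<^sub>R e)"
    by simp
  then show ?thesis
    by (simp add: inner_add_right power2_eq_square)
qed

text \<open>
  Every point of a nondegenerate interval, an end point included, is a limit point of the
  interval; therefore the derivative within the interval is unique.
\<close>

lemma constant_inner_derivative:
  fixes X V :: "real \<Rightarrow> 'a::real_inner"
  assumes I: "is_interval I" "interior I \<noteq> {}" and s: "s \<in> I"
    and X: "(X has_vector_derivative X') (at s within I)"
    and V: "(V has_vector_derivative V') (at s within I)"
    and const: "\<And>u. u \<in> I \<Longrightarrow> X u \<bullet> V u = d"
  shows "X s \<bullet> V' + X' \<bullet> V s = 0"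
proof -
  have "s islimpt I"
  proof (rule connected_imp_perfect)
    show "connected I" using I(1) by (rule is_interval_connected)
    show "I \<noteq> {x}" for x using I(2) by auto
  qed (fact s)
  then have "at s within I \<noteq> bot"
    by (simp add: trivial_limit_within)
  moreover have "((\<lambda>u. X u \<bullet> V u) has_vector_derivative X s \<bullet> V' + X' \<bullet> V s) (at s within I)"
    by (rule bounded_bilinear.has_vector_derivative[OF bounded_bilinear_inner X V])
  moreover have "((\<lambda>u. X u \<bullet> V u) has_vector_derivative 0) (at s within I)"
    by (rule has_vector_derivative_transform[OF s _ has_vector_derivative_const[of d]])
      (simp add: const)
  ultimately show ?thesis
    by (rule vector_derivative_unique_within)
qed

text \<open>Between unit vectors the angle determines the inner product, as \<open>arccos\<close> is injective.\<close>

lemma makes_constant_angleE: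
  assumes "makes_constant_angle I V" and unit: "\<And>s. s \<in> I \<Longrightarrow> norm (V s) = 1"
  obtains U d where "norm U = 1" "\<And>s. s \<in> I \<Longrightarrow> U \<bullet> V s = d"
proof -
  obtain U \<theta> where U: "norm U = 1" and angle: "\<And>s. s \<in> I \<Longrightarrow> angle_between (V s) U = \<theta>"
    using assms(1) by (auto simp: makes_constant_angle_def constant_on_def)
  have "U \<bullet> V s = cos \<theta>" if s: "s \<in> I" for s
  proof -
    have "\<bar>V s \<bullet> U\<bar> \<le> 1"
      using Cauchy_Schwarz_ineq2[of "V s" U] U unit[OF s] by simp
    moreover have "arccos (V s \<bullet> U) = \<theta>"
      using angle[OF s] U unit[OF s] by (simp add: angle_between_def)
    ultimately show ?thesis
      by (metis cos_arccos_abs inner_commute)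
  qed
  with U show ?thesis by (rule that)
qed

locale constant_frenet4 =
  fixes I :: "real set" and \<alpha> T N B E :: "real \<Rightarrow> real^4" and k t w :: real
  assumes frenet: "frenet_curve4 I \<alpha> T N B E (\<lambda>_. k) (\<lambda>_. t) (\<lambda>_. w)"
    and nonzero: "k \<noteq> 0" "t \<noteq> 0" "w \<noteq> 0"
begin

lemma interval: "is_interval I" "interior I \<noteq> {}"
  using frenet by (auto simp: frenet_curve4_def)

lemma nonempty: "I \<noteq> {}"
  using interval(2) by auto

lemma frame:
  assumes "s \<in> I"
  shows "orthonormal4 (T s) (N s) (B s) (E s)"
  using frenet assms by (simp add: frenet_curve4_def)

lemma frame_derivatives:
  assumes "s \<in> I"
  shows "(\<alpha> has_vector_derivative T s) (at s within I)"
    and "(T has_vector_derivative k *\<^sub>R N s) (at s within I)"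
    and "(N has_vector_derivative - k *\<^sub>R T s + t *\<^sub>R B s) (at s within I)"
    and "(B has_vector_derivative - t *\<^sub>R N s + w *\<^sub>R E s) (at s within I)"
    and "(E has_vector_derivative - w *\<^sub>R B s) (at s within I)"
  using frenet assms by (auto simp: frenet_curve4_def)

context
  fixes X :: "real \<Rightarrow> real^4" and a :: real
  assumes X: "\<And>s. s \<in> I \<Longrightarrow> (X has_vector_derivative a *\<^sub>R T s) (at s within I)"
begin

text \<open>
  The Frenet equations read in coordinates. The constant \<open>a\<close> enters only the first relation,
  since \<open>X'\<close> is orthogonal to \<open>N\<close>, \<open>B\<close> and \<open>E\<close>.
\<close>

lemma constant_coordinate_relations:
  assumes s: "s \<in> I"
  shows "(\<And>u. u \<in> I \<Longrightarrow> X u \<bullet> T u = d) \<Longrightarrow> k * (X s \<bullet> N s) = - a"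
    and "(\<And>u. u \<in> I \<Longrightarrow> X u \<bullet> N u = d) \<Longrightarrow> t * (X s \<bullet> B s) = k * (X s \<bullet> T s)"
    and "(\<And>u. u \<in> I \<Longrightarrow> X u \<bullet> B u = d) \<Longrightarrow> w * (X s \<bullet> E s) = t * (X s \<bullet> N s)"
    and "(\<And>u. u \<in> I \<Longrightarrow> X u \<bullet> E u = d) \<Longrightarrow> X s \<bullet> B s = 0"
proof -
  note rate = constant_inner_derivative[OF interval s X[OF s]]
  have orth: "T s \<bullet> T s = 1" "T s \<bullet> N s = 0" "T s \<bullet> B s = 0" "T s \<bullet> E s = 0"
    using frame[OF s] by (auto simp: orthonormal4_def norm_eq_1)
  show "k * (X s \<bullet> N s) = - a" if "\<And>u. u \<in> I \<Longrightarrow> X u \<bullet> T u = d"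
    using rate[OF frame_derivatives(2)[OF s] that] orth by (simp add: algebra_simps)
  show "t * (X s \<bullet> B s) = k * (X s \<bullet> T s)" if "\<And>u. u \<in> I \<Longrightarrow> X u \<bullet> N u = d"
    using rate[OF frame_derivatives(3)[OF s] that] orth by (simp add: algebra_simps)
  show "w * (X s \<bullet> E s) = t * (X s \<bullet> N s)" if "\<And>u. u \<in> I \<Longrightarrow> X u \<bullet> B u = d"
    using rate[OF frame_derivatives(4)[OF s] that] orth by (simp add: algebra_simps)
  show "X s \<bullet> B s = 0" if "\<And>u. u \<in> I \<Longrightarrow> X u \<bullet> E u = d"
    using rate[OF frame_derivatives(5)[OF s] that] orth nonzero by simp
qed

text \<open>
  The chain \<open>T \<rightarrow> N \<rightarrow> B \<rightarrow> E\<close>: each relation makes the next coordinate constant, so that the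
  following relation becomes available. The last one gives \<open>X \<bullet> B = 0\<close>, and the second one then
  shows that the constant \<open>X \<bullet> T\<close> has to be \<open>0\<close>.
\<close>

lemma coordinates_if_tangential_constant:
  assumes const: "\<And>s. s \<in> I \<Longrightarrow> X s \<bullet> T s = d" and s: "s \<in> I"
  shows "X s \<bullet> T s = 0" "X s \<bullet> N s = - a / k" "X s \<bullet> B s = 0" "X s \<bullet> E s = - (a * t) / (k * w)"
proof -
  have N: "X u \<bullet> N u = - a / k" if "u \<in> I" for u
    using constant_coordinate_relations(1)[OF that const] nonzero by (simp add: field_simps)
  have B: "X u \<bullet> B u = k * d / t" if "u \<in> I" for u
    using constant_coordinate_relations(2)[OF that N] const[OF that] nonzero
    by (simp add: field_simps)
  have E: "X u \<bullet> E u = - (a * t) / (k * w)" if "u \<in> I" for u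
    using constant_coordinate_relations(3)[OF that B] N[OF that] nonzero
    by (simp add: field_simps)
  show "X s \<bullet> B s = 0"
    by (rule constant_coordinate_relations(4)[OF s E])
  with constant_coordinate_relations(2)[OF s N] show "X s \<bullet> T s = 0"
    using nonzero by simp
  show "X s \<bullet> N s = - a / k" "X s \<bullet> E s = - (a * t) / (k * w)"
    using N[OF s] E[OF s] by auto
qed

lemma norm_if_tangential_constant:
  assumes const: "\<And>s. s \<in> I \<Longrightarrow> X s \<bullet> T s = d" and s: "s \<in> I"
  shows "norm (X s) = \<bar>a\<bar> * sqrt (t\<^sup>2 + w\<^sup>2) / \<bar>k * w\<bar>"
proof -
  have "X s \<bullet> X s = (- a / k)\<^sup>2 + (- (a * t) / (k * w))\<^sup>2"
    using orthonormal4_Parseval[OF frame[OF s], of "X s"]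
      coordinates_if_tangential_constant[OF const s] by simp
  also have "\<dots> = a\<^sup>2 * (t\<^sup>2 + w\<^sup>2) / (k * w)\<^sup>2"
    using nonzero by (simp add: field_simps power2_eq_square)
  finally show ?thesis
    by (simp add: norm_eq_sqrt_inner real_sqrt_mult real_sqrt_divide)
qed

end

text \<open>
  From \<open>U \<bullet> B = 0\<close> the relations make \<open>U \<bullet> N\<close> constant and then \<open>U \<bullet> T\<close> zero. Turning back at \<open>T\<close>,
  the first relation improves \<open>U \<bullet> N\<close> from constant to zero, and this carries over to \<open>U \<bullet> E\<close>.
\<close>

lemma zero_if_trinormal_constant:
  assumes const: "\<And>s. s \<in> I \<Longrightarrow> U \<bullet> E s = d"
  shows "U = 0"
proof -
  have "((\<lambda>_. U) has_vector_derivative 0 *\<^sub>R T s) (at s within I)" for s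
    by simp
  note rel = constant_coordinate_relations[OF this]
  have B: "U \<bullet> B s = 0" if "s \<in> I" for s
    by (rule rel(4)[OF that const])
  have N: "U \<bullet> N s = w * d / t" if "s \<in> I" for s
    using rel(3)[OF that B] const[OF that] nonzero by (simp add: field_simps)
  have T: "U \<bullet> T s = 0" if "s \<in> I" for s
    using rel(2)[OF that N] B[OF that] nonzero by simp
  obtain s where s: "s \<in> I"
    using nonempty by auto
  have "U \<bullet> N s = 0"
    using rel(1)[OF s T] nonzero by simp
  moreover have "U \<bullet> E s = 0"
    using rel(3)[OF s B] \<open>U \<bullet> N s = 0\<close> nonzero by simp
  ultimately have "U \<bullet> U = 0"
    using orthonormal4_Parseval[OF frame[OF s], of U] T[OF s] B[OF s] by simp
  then show ?thesis by simp
qed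

lemma not_generalized_helix: "\<not> generalized_helix I T"
proof
  assume "generalized_helix I T"
  then have "makes_constant_angle I T"
    by (simp add: generalized_helix_def)
  then obtain U d where U: "norm U = 1" and const: "\<And>s. s \<in> I \<Longrightarrow> U \<bullet> T s = d"
    using frame by (auto simp: orthonormal4_def elim: makes_constant_angleE)
  have "((\<lambda>_. U) has_vector_derivative 0 *\<^sub>R T s) (at s within I)" for s
    by simp
  from norm_if_tangential_constant[OF this const] U nonempty show False
    by auto
qed

lemma not_slant_helix_type3: "\<not> slant_helix_type3 I E"
proof
  assume "slant_helix_type3 I E"
  then have "makes_constant_angle I E"
    by (simp add: slant_helix_type3_def)
  then obtain U d where U: "norm U = 1" and const: "\<And>s. s \<in> I \<Longrightarrow> U \<bullet> E s = d"
    using frame by (auto simp: orthonormal4_def elim: makes_constant_angleE)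
  from zero_if_trinormal_constant[OF const] U show False
    by simp
qed

lemma sphere_radius:
  assumes sphere: "\<alpha> ` I \<subseteq> sphere c r"
  shows "r = sqrt (t\<^sup>2 + w\<^sup>2) / \<bar>k * w\<bar>"
proof -
  have pos: "((\<lambda>u. \<alpha> u - c) has_vector_derivative T s) (at s within I)" if "s \<in> I" for s
    using has_vector_derivative_diff_const[of \<alpha> c "T s"] frame_derivatives(1)[OF that] by simp
  have radius: "norm (\<alpha> s - c) = r" if "s \<in> I" for s
    using sphere that by (auto simp: dist_norm norm_minus_commute)
  then have "(\<alpha> s - c) \<bullet> (\<alpha> s - c) = r\<^sup>2" if "s \<in> I" for s
    using that by (simp add: power2_norm_eq_inner[symmetric])
  then have "(\<alpha> s - c) \<bullet> T s = 0" if "s \<in> I" for s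
    using constant_inner_derivative[OF interval that pos[OF that] pos[OF that]]
    by (simp add: inner_commute)
  moreover obtain s where "s \<in> I"
    using nonempty by auto
  ultimately show ?thesis
    using norm_if_tangential_constant[of "\<lambda>u. \<alpha> u - c" 1] pos radius by simp
qed

end

theorem theorem3p4:
  fixes I :: "real set" and \<alpha> T N B E :: "real \<Rightarrow> real^4" and \<kappa> \<tau> \<sigma> :: "real \<Rightarrow> real"
  assumes helix: "helix4 I \<alpha> T N B E \<kappa> \<tau> \<sigma>"
    and nonzero: "\<forall>s\<in>I. \<kappa> s \<noteq> 0 \<and> \<tau> s \<noteq> 0 \<and> \<sigma> s \<noteq> 0"
  shows "\<not> generalized_helix I T
    \<and> \<not> slant_helix_type3 I E
    \<and> (\<forall>c r. \<alpha> ` I \<subseteq> sphere c r \<longrightarrow>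
         (\<forall>s\<in>I. r = sqrt ((\<tau> s)\<^sup>2 + (\<sigma> s)\<^sup>2) / \<bar>\<kappa> s * \<sigma> s\<bar>))"
proof -
  obtain k t w where const: "\<And>s. s \<in> I \<Longrightarrow> \<kappa> s = k" "\<And>s. s \<in> I \<Longrightarrow> \<tau> s = t"
      "\<And>s. s \<in> I \<Longrightarrow> \<sigma> s = w"
    using helix by (auto simp: helix4_def constant_on_def)
  have "frenet_curve4 I \<alpha> T N B E \<kappa> \<tau> \<sigma>"
    using helix by (simp add: helix4_def)
  then have frenet: "frenet_curve4 I \<alpha> T N B E (\<lambda>_. k) (\<lambda>_. t) (\<lambda>_. w)"
    using const by (simp add: frenet_curve4_def)
  then have "I \<noteq> {}"
    by (auto simp: frenet_curve4_def)
  then have "k \<noteq> 0" "t \<noteq> 0" "w \<noteq> 0"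
    using nonzero const by auto
  with frenet interpret constant_frenet4 I \<alpha> T N B E k t w
    by unfold_locales
  show ?thesis
    using not_generalized_helix not_slant_helix_type3 sphere_radius const by auto
qed

end
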